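(* Let $n\in\mathbb N_0$, $t\in\mathbb C$, let $\alpha,\beta>0$ be real, and let $c,d\in(0,1)$. Then $$\sum_{x=0}^{\infty}{}_1F_1\!\left(\begin{matrix}-x\\ \alpha\end{matrix};\frac{t(1-c)}{c}\right)M_n(x;\beta,d)\,\frac{d^x(\beta)_x}{x!}=\frac{t^n(1-c)^n}{c^n(1-d)^{n+\beta}(\alpha)_n}\;{}_1F_1\!\left(\begin{matrix}\beta+n\\ \alpha+n\end{matrix};\frac{-dt(1-c)}{c(1-d)}\right).$$
   Context: $\mathbb N_0=\{0,1,2,\dots\}$. Pochhammer symbol: $(a)_n=a(a+1)\cdots(a+n-1)$, $(a)_0=1$. ${}_1F_1\!\left(\begin{matrix}a\\ b\end{matrix};z\right)=\sum_{k\ge0}\frac{(a)_k}{(b)_k}\frac{z^k}{k!}$. Meixner polynomials: $M_n(x;\beta,d)={}_2F_1\!\left(\begin{matrix}-n,\,-x\\ \beta\end{matrix};1-\frac1d\right)=\sum_{k=0}^n\frac{(-n)_k(-x)_k}{(\beta)_k\,k!}\left(1-\frac1d\right)^k$. *)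

theory Defs
  imports "HOL-Analysis.Analysis"
begin

text \<open>
  The denominator parameter \<open>b\<close> is meant not to be a nonpositive integer; the
  series of \<open>hyp2F1\<close> is meant for \<open>norm z < 1\<close> or for terminating series.
\<close>

definition hyp1F1 :: "complex \<Rightarrow> complex \<Rightarrow> complex \<Rightarrow> complex" where
  "hyp1F1 a b z = (\<Sum>k. pochhammer a k / pochhammer b k * (z ^ k / fact k))"

definition hyp2F1 :: "complex \<Rightarrow> complex \<Rightarrow> complex \<Rightarrow> complex \<Rightarrow> complex" where
  "hyp2F1 a a' b z = (\<Sum>k. pochhammer a k * pochhammer a' k / pochhammer b k * (z ^ k / fact k))"

definition meixner :: "nat \<Rightarrow> complex \<Rightarrow> real \<Rightarrow> real \<Rightarrow> complex" where
  "meixner n x \<beta> d =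
     hyp2F1 (- of_nat n) (- x) (complex_of_real \<beta>) (1 - 1 / complex_of_real d)"

lemma meixner_eq_sum:
  "meixner n x \<beta> d =
     (\<Sum>k\<le>n. pochhammer (- of_nat n) k * pochhammer (- x) k
              / (pochhammer (complex_of_real \<beta>) k * fact k) * (1 - 1 / complex_of_real d) ^ k)"
proof -
  have "meixner n x \<beta> d =
     (\<Sum>k\<le>n. pochhammer (- of_nat n) k * pochhammer (- x) k / pochhammer (complex_of_real \<beta>) k
              * ((1 - 1 / complex_of_real d) ^ k / fact k))"
    unfolding meixner_def hyp2F1_def
    by (rule suminf_finite) (auto simp: pochhammer_of_nat_eq_0_lemma)
  also have "\<dots> = (\<Sum>k\<le>n. pochhammer (- of_nat n) k * pochhammer (- x) k
              / (pochhammer (complex_of_real \<beta>) k * fact k) * (1 - 1 / complex_of_real d) ^ k)"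
    by (rule sum.cong) auto
  finally show ?thesis .
qed

end

theory Submission
  imports Defs
begin

text \<open>
  Put \<open>s = t (1 - c) / c\<close> and write \<open>L\<^sub>x(\<alpha>)\<close> for the polynomial \<open>\<^sub>1F\<^sub>1(-x; \<alpha>; s)\<close> (a Laguerre
  polynomial up to normalization) and \<open>g\<^sub>x(n, \<beta>) = M\<^sub>n(x; \<beta>, d) (\<beta>)\<^sub>x / x!\<close>. The sum in question is
  \<open>\<Sum>\<^sub>x L\<^sub>x(\<alpha>) g\<^sub>x(n, \<beta>) d\<^sup>x\<close>, and it is evaluated by induction on \<open>n\<close>, for all \<open>\<alpha>\<close> and \<open>\<beta>\<close> at once.

  The generating function \<open>\<Sum>\<^sub>x g\<^sub>x(n, \<beta>) y\<^sup>x = (1 - y)\<^bsup>-\<beta>-n\<^esup> (1 - y/d)\<^sup>n\<close> suggests the induction: raising \<open>n\<close>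
  by one at the cost of replacing \<open>\<beta>\<close> by \<open>\<beta> + 1\<close> multiplies it by \<open>1 - y/d\<close>. On coefficients this is
  the backward shift relation \<open>g\<^sub>x(n+1, \<beta>) = g\<^sub>x(n, \<beta>+1) - g\<^bsub>x-1\<^esub>(n, \<beta>+1) / d\<close>
  (\<open>meixner_weighted_Suc\<close>), so \<open>g\<^sub>x(n+1, \<beta>) d\<^sup>x\<close> is the backward difference of \<open>g\<^sub>x(n, \<beta>+1) d\<^sup>x\<close>.
  Summation by parts moves the difference onto the other factor, where
  \<open>L\<^sub>x(\<alpha>) - L\<^bsub>x+1\<^esub>(\<alpha>) = (s/\<alpha>) L\<^sub>x(\<alpha>+1)\<close> (\<open>hyp1F1_neg_nat_diff\<close>). Hence the sum for \<open>(n+1, \<alpha>, \<beta>)\<close> is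
  \<open>s/\<alpha>\<close> times the sum for \<open>(n, \<alpha>+1, \<beta>+1)\<close>, and the claimed right-hand side obeys the same recursion.

  The case \<open>n = 0\<close> (\<open>laguerre_generating_sum\<close>) is an interchange of summations: the coefficient of
  \<open>s\<^sup>k\<close> is a factorial moment of the negative binomial weight \<open>(\<beta>)\<^sub>x d\<^sup>x / x!\<close>, which is a binomial series.
  Both the interchange and the vanishing of the boundary term in the summation by parts come from
  growth bounds: \<open>L\<^sub>x(\<alpha>)\<close> is \<open>O(q\<^sup>x)\<close> for every \<open>q > 1\<close>, while \<open>g\<^sub>x(n, \<beta>) r\<^sup>x\<close> tends to \<open>0\<close> for \<open>0 < r < 1\<close> and
  is summable when \<open>n = 0\<close>. With \<open>q = 1 / sqrt d\<close> and \<open>r = sqrt d\<close> the factor \<open>d\<^sup>x = r\<^sup>x / q\<^sup>x\<close> pays for both.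
\<close>

section \<open>Terminating Kummer functions\<close>

lemma hyp1F1_neg_nat_eq_sum:
  assumes "x \<le> N"
  shows "hyp1F1 (- of_nat x) b z =
           (\<Sum>k\<le>N. of_nat (x choose k) * (- z) ^ k / pochhammer b k)"
proof -
  have coeff: "pochhammer (- of_nat x) k / pochhammer b k * (z ^ k / fact k) =
                 of_nat (x choose k) * (- z) ^ k / pochhammer b k" for k
    by (simp add: binomial_gbinomial gbinomial_pochhammer power_minus[of z] mult_ac)
  show ?thesis
    unfolding hyp1F1_def coeff using assms by (intro suminf_finite) auto
qed

text \<open>
  Termwise this is Pascal's rule: the coefficient \<open>x choose k\<close> loses \<open>x choose (k - 1)\<close>, and the
  index shift turns \<open>(a)\<^sub>k\<close> into \<open>a (a + 1)\<^bsub>k-1\<^esub>\<close>.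
\<close>
lemma hyp1F1_neg_nat_diff:
  assumes "a \<noteq> 0"
  shows "hyp1F1 (- of_nat x) a s - hyp1F1 (- of_nat (Suc x)) a s =
           s / a * hyp1F1 (- of_nat x) (a + 1) s"
proof -
  have "hyp1F1 (- of_nat x) a s - hyp1F1 (- of_nat (Suc x)) a s =
          (\<Sum>k\<le>Suc x. (of_nat (x choose k) - of_nat (Suc x choose k)) * (- s) ^ k / pochhammer a k)"
    by (subst (1 2) hyp1F1_neg_nat_eq_sum[where N = "Suc x"])
       (simp_all add: left_diff_distrib diff_divide_distrib sum_subtractf)
  also have "\<dots> = (\<Sum>k\<le>x. - of_nat (x choose k) * (- s) ^ Suc k / pochhammer a (Suc k))"
    by (subst sum.atMost_Suc_shift) simp
  also have "\<dots> = s / a * (\<Sum>k\<le>x. of_nat (x choose k) * (- s) ^ k / pochhammer (a + 1) k)"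
    unfolding sum_distrib_left by (intro sum.cong refl) (simp add: pochhammer_rec)
  finally show ?thesis
    by (simp add: hyp1F1_neg_nat_eq_sum[of x x])
qed

lemma summable_power_over_pochhammer:
  fixes \<alpha> y :: real
  assumes "\<alpha> > 0" "y \<ge> 0"
  shows "summable (\<lambda>k. y ^ k / pochhammer \<alpha> k)"
proof (rule summable_ratio_test)
  show "(1/2::real) < 1" by simp
  fix k assume k: "nat \<lceil>2 * y\<rceil> \<le> k"
  have le: "y / (\<alpha> + real k) \<le> 1 / 2"
    using assms k by (simp add: field_simps)
  have pos: "pochhammer \<alpha> k > 0"
    using assms by (simp add: pochhammer_pos)
  have "norm (y ^ Suc k / pochhammer \<alpha> (Suc k)) = y / (\<alpha> + real k) * (y ^ k / pochhammer \<alpha> k)"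
    using assms pos by (simp add: pochhammer_Suc abs_mult)
  also have "\<dots> \<le> 1 / 2 * (y ^ k / pochhammer \<alpha> k)"
    using assms pos by (intro mult_right_mono le) simp
  finally show "norm (y ^ Suc k / pochhammer \<alpha> (Suc k)) \<le> 1 / 2 * norm (y ^ k / pochhammer \<alpha> k)"
    using assms pos by simp
qed

text \<open>
  Each term \<open>(x choose k) (q - 1)\<^sup>k\<close> is at most \<open>(1 + (q - 1))\<^sup>x = q\<^sup>x\<close>; the price \<open>(q - 1)\<^bsup>-k\<^esup>\<close> is
  absorbed by the factorial growth of \<open>(\<alpha>)\<^sub>k\<close>.
\<close>
lemma laguerre_abs_sum_bound:
  fixes \<alpha> r q :: real
  assumes "\<alpha> > 0" "r \<ge> 0" "q > 1"
  obtains C where "\<And>x. (\<Sum>k\<le>x. of_nat (x choose k) * r ^ k / pochhammer \<alpha> k) \<le> C * q ^ x"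
proof
  define a where "a k = (r / (q - 1)) ^ k / pochhammer \<alpha> k" for k
  have a_nonneg: "a k \<ge> 0" for k
    using assms by (simp add: a_def pochhammer_nonneg)
  have summ: "summable a"
    unfolding a_def using assms by (intro summable_power_over_pochhammer) auto
  fix x
  have binom: "real (x choose k) * (q - 1) ^ k \<le> q ^ x" if "k \<le> x" for k
  proof -
    have "real (x choose k) * (q - 1) ^ k \<le> (\<Sum>j\<le>x. real (x choose j) * (q - 1) ^ j)"
      using assms that by (intro member_le_sum) auto
    also have "\<dots> = q ^ x"
      using binomial_ring[of "q - 1" 1 x] by simp
    finally show ?thesis .
  qed
  have "(\<Sum>k\<le>x. real (x choose k) * r ^ k / pochhammer \<alpha> k) =
          (\<Sum>k\<le>x. real (x choose k) * (q - 1) ^ k * a k)"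
    using assms by (intro sum.cong) (auto simp: a_def power_divide)
  also have "\<dots> \<le> (\<Sum>k\<le>x. q ^ x * a k)"
    by (intro sum_mono mult_right_mono binom a_nonneg) auto
  also have "\<dots> = (\<Sum>k\<le>x. a k) * q ^ x"
    by (subst sum_distrib_right) (simp add: mult.commute)
  also have "\<dots> \<le> suminf a * q ^ x"
    using assms summ a_nonneg by (intro mult_right_mono sum_le_suminf) auto
  finally show "(\<Sum>k\<le>x. real (x choose k) * r ^ k / pochhammer \<alpha> k) \<le> suminf a * q ^ x" .
qed

lemma norm_pochhammer_of_real:
  fixes \<alpha> :: real
  assumes "\<alpha> > 0"
  shows "norm (pochhammer (complex_of_real \<alpha>) k) = pochhammer \<alpha> k"
  using assms by (simp add: pochhammer_of_real pochhammer_nonneg)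

lemma hyp1F1_neg_nat_bound:
  fixes \<alpha> q :: real and s :: complex
  assumes "\<alpha> > 0" "q > 1"
  obtains C where "\<And>x. norm (hyp1F1 (- of_nat x) (of_real \<alpha>) s) \<le> C * q ^ x"
proof -
  obtain C where C: "\<And>x. (\<Sum>k\<le>x. of_nat (x choose k) * norm s ^ k / pochhammer \<alpha> k) \<le> C * q ^ x"
    using laguerre_abs_sum_bound[of \<alpha> "norm s" q] assms by auto
  have "norm (hyp1F1 (- of_nat x) (of_real \<alpha>) s) \<le> C * q ^ x" for x
  proof -
    have "norm (hyp1F1 (- of_nat x) (of_real \<alpha>) s) \<le>
            (\<Sum>k\<le>x. norm (of_nat (x choose k) * (- s) ^ k / pochhammer (complex_of_real \<alpha>) k))"
      unfolding hyp1F1_neg_nat_eq_sum[OF order_refl] by (rule norm_sum)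
    also have "\<dots> = (\<Sum>k\<le>x. of_nat (x choose k) * norm s ^ k / pochhammer \<alpha> k)"
      using assms by (simp add: norm_divide norm_mult norm_power norm_pochhammer_of_real)
    also have "\<dots> \<le> C * q ^ x" by (rule C)
    finally show ?thesis .
  qed
  with that show thesis by blast
qed

section \<open>Weighted Meixner polynomials\<close>

definition meixner_weighted :: "nat \<Rightarrow> real \<Rightarrow> real \<Rightarrow> nat \<Rightarrow> complex" where
  "meixner_weighted n \<beta> d x =
     meixner n (of_nat x) \<beta> d * (pochhammer (of_real \<beta>) x / fact x)"

text \<open>
  Compare the coefficients of \<open>u\<^sup>k\<close>, where \<open>u = 1 - 1/d\<close> and hence \<open>1/d = 1 - u\<close>. By
  \<open>x (1 - x)\<^sub>k = (x - k) (-x)\<^sub>k\<close> every contribution is a multiple of \<open>(-x)\<^sub>k\<close>, and the identity reduces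
  to \<open>(-n)\<^sub>k - k (-n)\<^bsub>k-1\<^esub> = (-n-1)\<^sub>k\<close>.
\<close>
lemma meixner_backward_shift:
  fixes x :: complex and \<beta> d :: real
  assumes "\<beta> > 0" "d \<noteq> 0"
  shows "of_real \<beta> * meixner (Suc n) x \<beta> d =
           (of_real \<beta> + x) * meixner n x (\<beta> + 1) d - x / of_real d * meixner n (x - 1) (\<beta> + 1) d"
proof -
  define u where "u = 1 - 1 / complex_of_real d"
  define b where "b = complex_of_real \<beta>"
  define p where "p k = pochhammer (- of_nat n :: complex) k" for k
  define A where "A k = p k * pochhammer (- x) k / (pochhammer (b + 1) k * fact k) * u ^ k" for k
  define B where "B k = p k * pochhammer (1 - x) k / (pochhammer (b + 1) k * fact k) * u ^ k" for k
  have nz: "pochhammer (b + 1) k \<noteq> 0" "b + 1 + of_nat k \<noteq> 0" for k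
  proof -
    have "Re (b + 1 + of_nat k) > 0" for k
      using assms by (simp add: b_def)
    then have *: "b + 1 + of_nat k \<noteq> 0" for k
      by (metis less_irrefl zero_complex.simps(1))
    then show "b + 1 + of_nat k \<noteq> 0" .
    show "pochhammer (b + 1) k \<noteq> 0"
      using * by (auto simp: pochhammer_eq_0_iff eq_neg_iff_add_eq_0)
  qed
  have b0: "b \<noteq> 0" using assms by (simp add: b_def)
  \<comment> \<open>Terms beyond the degree vanish, so all sums can run up to \<open>Suc n\<close>.\<close>
  have trunc: "p (Suc n) = 0" by (simp add: p_def pochhammer_of_nat_eq_0_lemma)
  have "meixner n x (\<beta> + 1) d = (\<Sum>k\<le>n. A k)"
    unfolding meixner_eq_sum A_def p_def u_def b_def by simp
  then have MA: "meixner n x (\<beta> + 1) d = (\<Sum>k\<le>Suc n. A k)"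
    using trunc by (simp add: A_def)
  have MB': "meixner n (x - 1) (\<beta> + 1) d = (\<Sum>k\<le>n. B k)"
    unfolding meixner_eq_sum B_def p_def u_def b_def by simp
  then have MB: "meixner n (x - 1) (\<beta> + 1) d = (\<Sum>k\<le>Suc n. B k)"
    using trunc by (simp add: B_def)
  have d: "1 / complex_of_real d = 1 - u" by (simp add: u_def)
  define R where "R k = b * (pochhammer (- of_nat (Suc n)) k * pochhammer (- x) k
                          / (pochhammer b k * fact k) * u ^ k)" for k
  have lhs: "b * meixner (Suc n) x \<beta> d = (\<Sum>k\<le>Suc n. R k)"
    unfolding meixner_eq_sum R_def sum_distrib_left u_def b_def by simp
  have term0: "R 0 = (b + x) * A 0 - x * B 0"
    by (simp add: R_def A_def B_def p_def)
  \<comment> \<open>The extra summand \<open>x * u * B k\<close> comes from the \<open>u\<close> in \<open>1/d = 1 - u\<close>, which raises the power by one.\<close>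
  have term_Suc: "R (Suc k) = (b + x) * A (Suc k) - x * B (Suc k) + x * u * B k" for k
  proof -
    define D where "D = pochhammer (b + 1) k * fact (Suc k)"
    define P where "P = p k"
    define X where "X = pochhammer (1 - x) k"
    have D0: "D \<noteq> 0" using nz by (simp add: D_def del: fact_Suc)
    have px: "pochhammer (- x) (Suc k) = - x * X"
      by (simp add: pochhammer_rec X_def)
    have R: "R (Suc k) = - of_nat (Suc n) * P * (- x * X) / D * u ^ Suc k"
    proof -
      have "pochhammer (- of_nat (Suc n) :: complex) (Suc k) = - of_nat (Suc n) * P"
        by (simp add: pochhammer_rec P_def p_def)
      moreover have "pochhammer b (Suc k) = b * pochhammer (b + 1) k"
        by (simp add: pochhammer_rec)
      ultimately show ?thesis
        using b0 by (simp add: R_def px D_def del: fact_Suc of_nat_Suc)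
    qed
    have A: "(b + 1 + of_nat k) * A (Suc k) = (P * (of_nat k - of_nat n)) * (- x * X) / D * u ^ Suc k"
      unfolding A_def D_def px using nz
      by (simp add: pochhammer_Suc p_def P_def)
    have B: "(b + 1 + of_nat k) * B (Suc k) =
               (P * (of_nat k - of_nat n)) * (X * (1 - x + of_nat k)) / D * u ^ Suc k"
      unfolding B_def D_def using nz
      by (simp add: pochhammer_Suc p_def P_def X_def)
    have Bk: "u * B k = of_nat (Suc k) * P * X / D * u ^ Suc k"
      unfolding B_def D_def P_def X_def by (simp add: field_simps del: of_nat_Suc)
    \<comment> \<open>\<open>(b + x) (- x) - x (1 - x + k) = - x (b + 1 + k)\<close>, so the factor cancels.\<close>
    have "(b + 1 + of_nat k) * ((b + x) * A (Suc k) - x * B (Suc k)) =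
            (b + x) * ((b + 1 + of_nat k) * A (Suc k)) - x * ((b + 1 + of_nat k) * B (Suc k))"
      by (simp add: algebra_simps)
    also have "\<dots> = (b + 1 + of_nat k) * (P * (of_nat k - of_nat n) * (- x * X) / D * u ^ Suc k)"
      unfolding A B using D0 by (simp add: field_simps)
    finally have AB: "(b + x) * A (Suc k) - x * B (Suc k) =
                        P * (of_nat k - of_nat n) * (- x * X) / D * u ^ Suc k"
      using nz by (metis mult_left_cancel)
    have "R (Suc k) = P * (of_nat k - of_nat n) * (- x * X) / D * u ^ Suc k
                        + x * (of_nat (Suc k) * P * X / D * u ^ Suc k)"
      unfolding R using D0 by (simp add: field_simps)
    then show ?thesis by (simp add: AB Bk mult.assoc)
  qed
  have "(\<Sum>k\<le>Suc n. R k) = (\<Sum>k\<le>Suc n. (b + x) * A k - x * B k) + x * u * (\<Sum>k\<le>n. B k)"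
    unfolding sum.atMost_Suc_shift[of _ n] term0 term_Suc
    by (simp add: sum.distrib sum_distrib_left)
  also have "\<dots> = (b + x) * (\<Sum>k\<le>Suc n. A k) - x * (\<Sum>k\<le>Suc n. B k) + x * u * (\<Sum>k\<le>n. B k)"
    by (simp only: sum_subtractf sum_distrib_left)
  also have "\<dots> = (b + x) * meixner n x (\<beta> + 1) d - x * (1 - u) * meixner n (x - 1) (\<beta> + 1) d"
    unfolding MA[symmetric] MB[symmetric] MB'[symmetric] by (simp add: algebra_simps)
  finally show ?thesis
    unfolding lhs[symmetric] d[symmetric] by (simp add: b_def)
qed

lemma meixner_weighted_0 [simp]: "meixner_weighted n \<beta> d 0 = 1"
  unfolding meixner_weighted_def meixner_eq_sum
  by (simp add: pochhammer_0_left if_distrib if_distribR cong: if_cong)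

lemma meixner_weighted_degree_0 [simp]:
  "meixner_weighted 0 \<beta> d x = pochhammer (of_real \<beta>) x / fact x"
  by (simp add: meixner_weighted_def meixner_eq_sum)

lemma meixner_weighted_Suc:
  assumes "\<beta> > 0" "d \<noteq> 0"
  shows "meixner_weighted (Suc n) \<beta> d (Suc x) =
           meixner_weighted n (\<beta> + 1) d (Suc x) - meixner_weighted n (\<beta> + 1) d x / of_real d"
proof -
  let ?b = "complex_of_real \<beta>" and ?x = "complex_of_nat (Suc x)"
  let ?p = "pochhammer (?b + 1) x"
  have "meixner_weighted (Suc n) \<beta> d (Suc x) =
          ?b * meixner (Suc n) ?x \<beta> d * ?p / fact (Suc x)"
    unfolding meixner_weighted_def pochhammer_rec[of ?b] by simp
  also have "\<dots> = ((?b + ?x) * meixner n ?x (\<beta> + 1) d - ?x / of_real d * meixner n (of_nat x) (\<beta> + 1) d)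
                    * ?p / fact (Suc x)"
    using meixner_backward_shift[OF assms, of n ?x] by simp
  also have "\<dots> = meixner n ?x (\<beta> + 1) d * (?p * (?b + ?x)) / fact (Suc x)
                  - meixner n (of_nat x) (\<beta> + 1) d * ?p * (?x / fact (Suc x)) / of_real d"
    by (simp add: algebra_simps diff_divide_distrib del: of_nat_Suc fact_Suc)
  also have "?p * (?b + ?x) = pochhammer (of_real (\<beta> + 1)) (Suc x)"
    by (simp add: pochhammer_Suc add_ac)
  also have "?x / fact (Suc x) = 1 / fact x"
    by (simp del: of_nat_Suc)
  finally show ?thesis
    by (simp add: meixner_weighted_def)
qed

section \<open>Negative binomial weights\<close>

lemma pochhammer_binomial_series:
  fixes b d :: real
  assumes "0 < d" "d < 1"
  shows "(\<lambda>x. pochhammer b x / fact x * d ^ x) sums ((1 - d) powr (- b))"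
proof -
  have "(- b gchoose x) * (- d) ^ x = pochhammer b x / fact x * d ^ x" for x
    by (simp add: gbinomial_pochhammer power_minus[of d] mult_ac)
  then show ?thesis
    using gen_binomial_real[of "- d" "- b"] assms by simp
qed

text \<open>
  For degree zero the terms belong to a convergent binomial series; the backward shift relation
  propagates the decay to every degree.
\<close>
lemma meixner_weighted_times_power_tendsto_0:
  fixes r :: real
  assumes "\<beta> > 0" "d \<noteq> 0" "0 < r" "r < 1"
  shows "(\<lambda>x. meixner_weighted n \<beta> d x * of_real r ^ x) \<longlonglongrightarrow> 0"
  using assms(1)
proof (induction n arbitrary: \<beta>)
  case 0
  have "(\<lambda>x. complex_of_real (pochhammer \<beta> x / fact x * r ^ x)) \<longlonglongrightarrow> of_real 0"
    using pochhammer_binomial_series[of r \<beta>] assms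
    by (intro tendsto_of_real summable_LIMSEQ_zero) (auto simp: sums_iff)
  then show ?case by (simp add: pochhammer_of_real)
next
  case (Suc n)
  define f where "f x = meixner_weighted n (\<beta> + 1) d x * of_real r ^ x" for x
  have f: "f \<longlonglongrightarrow> 0"
    unfolding f_def using Suc.prems by (intro Suc.IH) simp
  have "(\<lambda>x. f (Suc x) - of_real (r / d) * f x) \<longlonglongrightarrow> 0 - of_real (r / d) * 0"
    by (intro tendsto_intros LIMSEQ_Suc f)
  also have "(\<lambda>x. f (Suc x) - of_real (r / d) * f x) =
               (\<lambda>x. meixner_weighted (Suc n) \<beta> d (Suc x) * of_real r ^ Suc x)"
    by (simp add: f_def meixner_weighted_Suc[OF Suc.prems assms(2)] algebra_simps)
  finally show ?case
    by - (rule LIMSEQ_imp_Suc, simp only: diff_0_right mult_zero_right)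
qed

text \<open>
  Only \<open>x = y + k\<close> contributes, and \<open>(b)\<^bsub>y+k\<^esub> = (b)\<^sub>k (b + k)\<^sub>y\<close> leaves the binomial series with
  parameter \<open>b + k\<close>.
\<close>
lemma binomial_moment_sums:
  fixes b d :: real
  assumes "0 < d" "d < 1"
  shows "(\<lambda>x. real (x choose k) * (pochhammer b x / fact x * d ^ x)) sums
           (pochhammer b k / fact k * d ^ k * (1 - d) powr (- (b + real k)))"
proof -
  define f where "f x = real (x choose k) * (pochhammer b x / fact x * d ^ x)" for x
  have shift: "f (y + k) = pochhammer b k / fact k * d ^ k * (pochhammer (b + real k) y / fact y * d ^ y)" for y
    using pochhammer_product'[of b k y]
    by (simp add: f_def binomial_fact power_add add_ac field_simps)
  have "(\<lambda>y. f (y + k)) sums (pochhammer b k / fact k * d ^ k * (1 - d) powr (- (b + real k)))"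
    unfolding shift by (intro sums_mult pochhammer_binomial_series assms)
  moreover have "(\<Sum>x<k. f x) = 0"
    by (intro sum.neutral) (simp add: f_def)
  ultimately show ?thesis
    using sums_iff_shift[of f k] unfolding f_def by simp
qed

section \<open>The sum for degree zero\<close>

text \<open>
  Expanding \<open>\<^sub>1F\<^sub>1(-x; \<alpha>; s)\<close> gives a double series. It converges absolutely because replacing \<open>s\<close> by
  \<open>-norm s\<close> still leaves rows of size \<open>O(q\<^sup>x)\<close>; summed by columns it consists of the factorial
  moments of the weight.
\<close>
lemma laguerre_generating_sum:
  fixes \<alpha> \<beta> d :: real and s :: complex
  assumes "\<alpha> > 0" "\<beta> > 0" "0 < d" "d < 1"
  shows "(\<lambda>x. hyp1F1 (- of_nat x) (of_real \<alpha>) s * (pochhammer (of_real \<beta>) x / fact x) * of_real d ^ x)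
           sums (hyp1F1 (of_real \<beta>) (of_real \<alpha>) (- (of_real d * s / (1 - of_real d)))
                  / of_real ((1 - d) powr \<beta>))"
proof -
  define w where "w x = pochhammer \<beta> x / fact x * d ^ x" for x
  have w_nonneg: "w x \<ge> 0" for x
    using assms by (simp add: w_def pochhammer_nonneg)
  \<comment> \<open>Rows are indexed by \<open>x\<close>, columns by the exponent \<open>k\<close> of \<open>s\<close>.\<close>
  define F where "F = (\<lambda>(x, k). of_real (real (x choose k) * w x) * (- s) ^ k
                                   / pochhammer (complex_of_real \<alpha>) k)"
  have norm_F: "norm (F (x, k)) = w x * (of_nat (x choose k) * norm s ^ k / pochhammer \<alpha> k)" for x k
    using assms w_nonneg
    by (simp add: F_def norm_divide norm_mult norm_power norm_pochhammer_of_real)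
  have row: "((\<lambda>k. F (x, k)) has_sum (of_real (w x) * hyp1F1 (- of_nat x) (of_real \<alpha>) s)) UNIV" for x
    by (rule has_sum_finite_neutralI[where B = "{..x}"])
       (auto simp: F_def hyp1F1_neg_nat_eq_sum[OF order_refl] sum_distrib_left mult_ac)
  have norm_row: "((\<lambda>k. norm (F (x, k))) has_sum
      (w x * (\<Sum>k\<le>x. of_nat (x choose k) * norm s ^ k / pochhammer \<alpha> k))) UNIV" for x
    unfolding norm_F
    by (rule has_sum_finite_neutralI[where B = "{..x}"]) (auto simp: sum_distrib_left)
  have summ: "F summable_on UNIV \<times> UNIV"
  proof -
    define q where "q = 1 / sqrt d"
    have q: "q > 1" using assms by (simp add: q_def)
    obtain C where C: "\<And>x. (\<Sum>k\<le>x. of_nat (x choose k) * norm s ^ k / pochhammer \<alpha> k) \<le> C * q ^ x"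
      using laguerre_abs_sum_bound[of \<alpha> "norm s" q] assms q by auto
    have "sqrt d > 0" "sqrt d < 1" using assms by auto
    note ser = pochhammer_binomial_series[OF this, of \<beta>]
    have "d * q = sqrt d" using assms by (simp add: q_def real_div_sqrt)
    then have wq: "w x * q ^ x = pochhammer \<beta> x / fact x * sqrt d ^ x" for x
      by (simp add: w_def flip: power_mult_distrib)
    have "summable (\<lambda>x. C * (w x * q ^ x))"
      unfolding wq using ser by (intro summable_mult) (auto simp: sums_iff)
    then have "summable (\<lambda>x. w x * (\<Sum>k\<le>x. of_nat (x choose k) * norm s ^ k / pochhammer \<alpha> k))"
    proof (rule summable_comparison_test_ev[rotated], intro always_eventually allI)
      fix x
      have "0 \<le> (\<Sum>k\<le>x. of_nat (x choose k) * norm s ^ k / pochhammer \<alpha> k)"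
        using assms by (intro sum_nonneg) (simp add: pochhammer_nonneg)
      then show "norm (w x * (\<Sum>k\<le>x. of_nat (x choose k) * norm s ^ k / pochhammer \<alpha> k))
                   \<le> C * (w x * q ^ x)"
        using mult_left_mono[OF C[of x] w_nonneg[of x]] w_nonneg[of x] by (simp add: mult_ac abs_mult)
    qed
    moreover have "0 \<le> w x * (\<Sum>k\<le>x. of_nat (x choose k) * norm s ^ k / pochhammer \<alpha> k)" for x
      using assms w_nonneg by (intro mult_nonneg_nonneg sum_nonneg) (simp_all add: pochhammer_nonneg)
    ultimately have "(\<lambda>x. norm (w x * (\<Sum>k\<le>x. of_nat (x choose k) * norm s ^ k / pochhammer \<alpha> k)))
                        summable_on UNIV"
      by (auto intro!: norm_summable_imp_summable_on)
    then have "(\<lambda>p. norm (F p)) summable_on UNIV \<times> UNIV"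
      unfolding Infinite_Sum.abs_summable_on_Sigma_iff infsumI[OF norm_row]
      using norm_row by (auto simp: summable_on_def)
    then show ?thesis by (rule Infinite_Sum.abs_summable_summable)
  qed
  then obtain S where S: "(F has_sum S) (UNIV \<times> UNIV)"
    by (auto simp: summable_on_def)
  have rows: "(\<lambda>x. of_real (w x) * hyp1F1 (- of_nat x) (of_real \<alpha>) s) sums S"
    by (rule has_sum_imp_sums, rule has_sum_SigmaD[OF S]) (rule row)
  define z where "z = - (of_real d * s / (1 - of_real d :: complex))"
  define c where "c k = pochhammer (of_real \<beta>) k / pochhammer (of_real \<alpha>) k * (z ^ k / fact k)
                          / complex_of_real ((1 - d) powr \<beta>)" for k
  have col: "((\<lambda>x. F (x, k)) has_sum c k) UNIV" for k
  proof -
    have "((\<lambda>x. real (x choose k) * w x) has_sum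
            (pochhammer \<beta> k / fact k * d ^ k * (1 - d) powr (- (\<beta> + real k)))) UNIV"
      using binomial_moment_sums[of d k \<beta>] assms w_nonneg
      by (intro sums_nonneg_imp_has_sum mult_nonneg_nonneg) (simp_all add: w_def)
    then have "((\<lambda>x. complex_of_real (real (x choose k) * w x)) has_sum
            of_real (pochhammer \<beta> k / fact k * d ^ k * (1 - d) powr (- (\<beta> + real k)))) UNIV"
      by (rule has_sum_of_real)
    then have "((\<lambda>x. complex_of_real (real (x choose k) * w x) * ((- s) ^ k / pochhammer (of_real \<alpha>) k))
        has_sum (of_real (pochhammer \<beta> k / fact k * d ^ k * (1 - d) powr (- (\<beta> + real k)))
          * ((- s) ^ k / pochhammer (of_real \<alpha>) k))) UNIV"
      by (rule has_sum_cmult_left)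
    moreover have "of_real (pochhammer \<beta> k / fact k * d ^ k * (1 - d) powr (- (\<beta> + real k)))
          * ((- s) ^ k / pochhammer (of_real \<alpha>) k) = c k"
    proof -
      have "(1 - d) powr (- (\<beta> + real k)) = 1 / ((1 - d) powr \<beta> * (1 - d) ^ k)"
        unfolding powr_minus_divide powr_add using assms by (simp add: powr_realpow)
      moreover have "z ^ k = (of_real d ^ k * (- s) ^ k) / (1 - of_real d) ^ k"
        by (simp add: z_def flip: power_mult_distrib power_divide)
      ultimately show ?thesis
        by (simp add: c_def pochhammer_of_real mult_ac)
    qed
    ultimately show ?thesis
      by (simp add: F_def)
  qed
  have "((\<lambda>(k, x). F (x, k)) has_sum S) (UNIV \<times> UNIV)"
    using S by (subst (asm) has_sum_swap)
  then have "(c has_sum S) UNIV"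
    by (rule has_sum_SigmaD) (use col in simp)
  then have "c sums S" by (rule has_sum_imp_sums)
  then have "(\<lambda>k. c k * of_real ((1 - d) powr \<beta>)) sums (S * of_real ((1 - d) powr \<beta>))"
    by (intro sums_mult2)
  then have "hyp1F1 (of_real \<beta>) (of_real \<alpha>) z = S * of_real ((1 - d) powr \<beta>)"
    using assms by (auto simp: c_def hyp1F1_def sums_iff)
  then have "S = hyp1F1 (of_real \<beta>) (of_real \<alpha>) z / of_real ((1 - d) powr \<beta>)"
    using assms by simp
  then show ?thesis
    using rows by (simp add: w_def z_def pochhammer_of_real mult_ac)
qed

section \<open>Raising the degree by summation by parts\<close>

lemma summation_by_parts_sums:
  fixes L g h :: "nat \<Rightarrow> 'a :: {real_normed_algebra, comm_ring}"
  assumes "(\<lambda>x. (L x - L (Suc x)) * g x) sums S"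
    and "(\<lambda>x. L (Suc x) * g x) \<longlonglongrightarrow> 0"
    and "h 0 = g 0" "\<And>x. h (Suc x) = g (Suc x) - g x"
  shows "(\<lambda>x. L x * h x) sums S"
proof -
  have partial: "(\<Sum>x<Suc N. L x * h x) = (\<Sum>x<Suc N. (L x - L (Suc x)) * g x) + L (Suc N) * g N" for N
    by (induction N) (simp_all add: assms algebra_simps)
  have "(\<lambda>N. (\<Sum>x<Suc N. (L x - L (Suc x)) * g x) + L (Suc N) * g N) \<longlonglongrightarrow> S + 0"
    using assms(1) by (intro tendsto_add assms(2) LIMSEQ_Suc) (simp add: sums_def)
  then show ?thesis
    unfolding partial[symmetric] sums_def add_0_right by (rule LIMSEQ_imp_Suc)
qed

lemma laguerre_meixner_sums:
  fixes \<alpha> \<beta> d :: real and s :: complex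
  assumes "\<alpha> > 0" "\<beta> > 0" "0 < d" "d < 1"
  shows "(\<lambda>x. hyp1F1 (- of_nat x) (of_real \<alpha>) s * (meixner_weighted n \<beta> d x * of_real d ^ x))
           sums (s ^ n / (of_real ((1 - d) powr (of_nat n + \<beta>)) * pochhammer (of_real \<alpha>) n)
                  * hyp1F1 (of_real \<beta> + of_nat n) (of_real \<alpha> + of_nat n)
                      (- (of_real d * s / (1 - of_real d))))"
  using assms(1,2)
proof (induction n arbitrary: \<alpha> \<beta>)
  case 0
  then show ?case
    using laguerre_generating_sum[of \<alpha> \<beta> d s] assms(3,4) by (simp add: mult_ac)
next
  case (Suc n)
  define L where "L x = hyp1F1 (- of_nat x) (of_real \<alpha>) s" for x
  define g where "g x = meixner_weighted n (\<beta> + 1) d x * of_real d ^ x" for x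
  define h where "h x = meixner_weighted (Suc n) \<beta> d x * of_real d ^ x" for x
  have L_diff: "L x - L (Suc x) = s / of_real \<alpha> * hyp1F1 (- of_nat x) (of_real (\<alpha> + 1)) s" for x
    unfolding L_def using hyp1F1_neg_nat_diff[of "of_real \<alpha>" x s] Suc.prems by simp
  have diff_sum: "(\<lambda>x. (L x - L (Suc x)) * g x) sums
      (s / of_real \<alpha> * (s ^ n / (of_real ((1 - d) powr (of_nat n + (\<beta> + 1))) * pochhammer (of_real (\<alpha> + 1)) n)
         * hyp1F1 (of_real (\<beta> + 1) + of_nat n) (of_real (\<alpha> + 1) + of_nat n)
             (- (of_real d * s / (1 - of_real d)))))"
    unfolding L_diff g_def mult.assoc using Suc.prems by (intro sums_mult Suc.IH) auto
  have boundary: "(\<lambda>x. L (Suc x) * g x) \<longlonglongrightarrow> 0"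
  proof -
    define q where "q = 1 / sqrt d"
    have q: "q > 1" using assms by (simp add: q_def)
    have dq: "q * d = sqrt d" using assms by (simp add: q_def real_div_sqrt)
    obtain C where C: "\<And>x. norm (L x) \<le> C * q ^ x"
      using hyp1F1_neg_nat_bound[of \<alpha> q s] Suc.prems q unfolding L_def by auto
    \<comment> \<open>Split \<open>d = sqrt d * sqrt d\<close>: one factor cancels the growth of \<open>L\<close>, the other makes \<open>v\<close> small.\<close>
    define v where "v x = meixner_weighted n (\<beta> + 1) d x * of_real (sqrt d) ^ x" for x
    have "v \<longlonglongrightarrow> 0"
      unfolding v_def using Suc.prems assms(3,4)
      by (intro meixner_weighted_times_power_tendsto_0) auto
    then have lim: "(\<lambda>x. C * q * norm (v x)) \<longlonglongrightarrow> 0"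
      by (intro tendsto_mult_right_zero tendsto_norm_zero)
    have "norm (L (Suc x) * g x) \<le> C * q * norm (v x)" for x
    proof -
      have "norm (L (Suc x) * g x) \<le> C * q ^ Suc x * norm (g x)"
        unfolding norm_mult by (intro mult_right_mono C) auto
      also have "\<dots> = C * q * (norm (meixner_weighted n (\<beta> + 1) d x) * (q * d) ^ x)"
        using assms(3) by (simp add: g_def norm_mult norm_power power_mult_distrib)
      also have "\<dots> = C * q * norm (v x)"
        using assms(3) by (simp add: dq v_def norm_mult norm_power)
      finally show ?thesis .
    qed
    then show ?thesis
      by (intro Lim_null_comparison[OF _ lim] always_eventually) auto
  qed
  have "h 0 = g 0" by (simp add: g_def h_def)
  moreover have "h (Suc x) = g (Suc x) - g x" for x
    using Suc.prems assms(3) by (simp add: g_def h_def meixner_weighted_Suc left_diff_distrib)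
  ultimately have "(\<lambda>x. L x * h x) sums
      (s / of_real \<alpha> * (s ^ n / (of_real ((1 - d) powr (of_nat n + (\<beta> + 1))) * pochhammer (of_real (\<alpha> + 1)) n)
         * hyp1F1 (of_real (\<beta> + 1) + of_nat n) (of_real (\<alpha> + 1) + of_nat n)
             (- (of_real d * s / (1 - of_real d)))))"
    by (rule summation_by_parts_sums[OF diff_sum boundary])
  then show ?case
    by (simp add: L_def h_def pochhammer_rec add_ac mult_ac)
qed

theorem corollary21:
  fixes n :: nat and t :: complex and \<alpha> \<beta> c d :: real
  assumes "\<alpha> > 0" and "\<beta> > 0" and "0 < c" and "c < 1" and "0 < d" and "d < 1"
  shows "(\<lambda>x::nat.
            hyp1F1 (- of_nat x) (of_real \<alpha>) (t * (1 - of_real c) / of_real c)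
            * meixner n (of_nat x) \<beta> d
            * (of_real d ^ x * pochhammer (of_real \<beta>) x / fact x))
         sums
         (t ^ n * (1 - of_real c) ^ n
            / (of_real c ^ n * of_real ((1 - d) powr (of_nat n + \<beta>)) * pochhammer (of_real \<alpha>) n)
          * hyp1F1 (of_real \<beta> + of_nat n) (of_real \<alpha> + of_nat n)
              (- of_real d * t * (1 - of_real c) / (of_real c * (1 - of_real d))))"
  using laguerre_meixner_sums[of \<alpha> \<beta> d "t * (1 - of_real c) / of_real c" n] assms
  by (simp add: meixner_weighted_def power_divide power_mult_distrib mult_ac)

end
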